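(* Let $A$ be a non-empty closed convex subset of $E^{n}$. If $A$ contains no hyperplane and its boundary $\partial A$ contains no ray, then $A=C(E(A))$.
   Context: $E^{n}$ is the $n$-dimensional Euclidean space, $n\ge 1$. $\partial A$ denotes the boundary of $A$ in $E^n$, and $C(S)$ denotes the convex hull of a set $S\subset E^n$, i.e. the intersection of all convex subsets of $E^n$ containing $S$. For a convex set $A$, a point $x\in A$ is an extreme point of $A$ if there is no non-degenerate line segment in $A$ that contains $x$ in its relative interior; $E(A)$ (the profile of $A$) denotes the set of all extreme points of $A$. A hyperplane is an affine subspace of $E^n$ of dimension $n-1$; a ray is a half-line emanating from a point $x$ through a different point $y$. *)

theory Defs imports "HOL-Analysis.Analysis" begin

definition is_hyperplane :: "'a::euclidean_space set \<Rightarrow> bool" where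
  "is_hyperplane H \<longleftrightarrow> affine H \<and> aff_dim H = int DIM('a) - 1"

definition is_ray :: "'a::euclidean_space set \<Rightarrow> bool" where
  "is_ray R \<longleftrightarrow> (\<exists>x y. x \<noteq> y \<and> R = {x + t *\<^sub>R (y - x) | t. 0 \<le> t})"

definition profile :: "'a::euclidean_space set \<Rightarrow> 'a set" where
  "profile A = {x. x extreme_point_of A}"

end

theory Submission imports Defs begin

text \<open>A supporting hyperplane at a
  boundary point cuts out of \<open>A\<close> a face lying in the boundary; without rays that face is compact, so
  by Krein--Milman the point is in the hull of its extreme points, which are extreme in \<open>A\<close>.
  For an interior point \<open>x\<close>, let \<open>A\<close> lie in a half-space with inner normal \<open>a\<close>. The hyperplane through
  \<open>x\<close> orthogonal to \<open>a\<close> leaves \<open>A\<close> in some direction \<open>d\<close>; tilting \<open>d\<close> slightly towards \<open>a\<close> makes the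
  opposite ray leave the half-space, so \<open>x\<close> lies between two boundary points.\<close>

text \<open>Compactness of directions: the unit vectors along which \<open>S\<close> contains a
  segment of length \<open>n\<close> from \<open>x\<close> form a decreasing sequence of non-empty
  compact sets \<open>F n\<close>. A direction common to all of them spans a ray in
  \<open>S\<close>.\<close>

lemma unbounded_closed_convex_contains_ray:
  fixes S :: "'a::euclidean_space set"
  assumes "closed S" "convex S" "\<not> bounded S"
  obtains R where "is_ray R" "R \<subseteq> S"
proof -
  obtain x where x: "x \<in> S"
    using assms(3) by (metis bounded_empty ex_in_conv)
  define F where "F n = sphere 0 1 \<inter> {d. x + real n *\<^sub>R d \<in> S}" for n
  \<comment> \<open>\<open>S\<close> is star-shaped about \<open>x\<close>. This gives the nesting
    of the \<open>F n\<close> and later the passage from integer to real lengths.\<close>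
  have step: "x + s *\<^sub>R d \<in> S" if "x + t *\<^sub>R d \<in> S" "0 \<le> s" "s \<le> t" for s t d
  proof (cases "t = 0")
    case False
    then have "(1 - s / t) *\<^sub>R x + (s / t) *\<^sub>R (x + t *\<^sub>R d) \<in> S"
      using that by (intro convexD[OF assms(2) x that(1)]) auto
    then show ?thesis
      using False by (simp add: algebra_simps)
  qed (use that x in auto)
  have "(\<Inter>n. F n) \<noteq> {}"
  proof (rule compact_nest)
    show "compact (F n)" for n
    proof -
      have "closed ((\<lambda>d. x + real n *\<^sub>R d) -` S)"
        by (intro closed_vimage assms(1) continuous_intros)
      then show ?thesis
        unfolding F_def by (intro compact_Int_closed compact_sphere) (simp add: vimage_def)
    qed
    show "F n \<noteq> {}" for n
    proof -
      obtain y where y: "y \<in> S" "\<not> norm (y - x) \<le> real n + 1"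
        using assms(3) unfolding bounded_def by (metis dist_norm norm_minus_commute)
      define d where "d = (1 / norm (y - x)) *\<^sub>R (y - x)"
      have n0: "norm (y - x) > 0" using y(2) by linarith
      then have "x + norm (y - x) *\<^sub>R d = y" by (simp add: d_def)
      then have "x + real n *\<^sub>R d \<in> S"
        using step[of "norm (y - x)" d "real n"] y by simp
      moreover have "norm d = 1" using n0 by (simp add: d_def)
      ultimately show ?thesis by (auto simp: F_def)
    qed
    show "F n \<subseteq> F m" if "m \<le> n" for m n
      using that step by (auto simp: F_def)
  qed
  then obtain d where d: "\<And>n. d \<in> F n" by blast
  \<comment> \<open>Round \<open>t\<close> up to an integer, where membership is known, and shrink
    back by \<open>step\<close>.\<close>
  have "x + t *\<^sub>R d \<in> S" if "0 \<le> t" for t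
    using step[OF _ that real_nat_ceiling_ge] d by (simp add: F_def)
  then have "{x + t *\<^sub>R ((x + d) - x) | t. 0 \<le> t} \<subseteq> S" by auto
  moreover have "is_ray {x + t *\<^sub>R ((x + d) - x) | t. 0 \<le> t}"
  proof -
    have "norm d = 1" using d by (auto simp: F_def)
    then have "x \<noteq> x + d" by auto
    then show ?thesis unfolding is_ray_def by blast
  qed
  ultimately show thesis using that by blast
qed

text \<open>If the interior is empty, \<open>A\<close> lies in a hyperplane whose normal is constant
  on \<open>A\<close>. Otherwise interior and relative interior agree, so \<open>x\<close> is a
  relative boundary point and the usual supporting hyperplane exists.\<close>

lemma frontier_supporting_functional:
  fixes A :: "'a::euclidean_space set"
  assumes "closed A" "convex A" "x \<in> frontier A"
  obtains a where "a \<noteq> 0" "\<And>y. y \<in> A \<Longrightarrow> a \<bullet> x \<le> a \<bullet> y"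
proof (cases "interior A = {}")
  case True
  then obtain a b where "a \<noteq> 0" "A \<subseteq> {y. a \<bullet> y = b}"
    using empty_interior_subset_hyperplane[OF assms(2)] by metis
  moreover have "x \<in> A" using assms by (simp add: frontier_def)
  ultimately have "a \<bullet> x \<le> a \<bullet> y" if "y \<in> A" for y
    using that by (simp add: subset_eq)
  then show thesis by (rule that[OF \<open>a \<noteq> 0\<close>])
next
  case False
  then have "rel_interior A = interior A" by (rule rel_interior_nonempty_interior)
  then have "x \<in> A" "x \<notin> rel_interior A"
    using assms by (auto simp: frontier_def)
  then show thesis
    by (rule supporting_hyperplane_rel_boundary[OF assms(2)]) (rule that)
qed

lemma frontier_subset_convex_hull_profile:
  fixes A :: "'a::euclidean_space set"
  assumes "closed A" "convex A" and noray: "\<not> (\<exists>R. is_ray R \<and> R \<subseteq> frontier A)"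
  shows "frontier A \<subseteq> convex hull (profile A)"
proof
  fix x assume x: "x \<in> frontier A"
  obtain a where a: "a \<noteq> 0" "\<And>y. y \<in> A \<Longrightarrow> a \<bullet> x \<le> a \<bullet> y"
    using frontier_supporting_functional[OF assms(1,2) x] by metis
  define F where "F = A \<inter> {y. a \<bullet> y = a \<bullet> x}"
  have face: "F face_of A"
    unfolding F_def using assms(2) a(2) by (intro face_of_Int_supporting_hyperplane_ge) auto
  have "closed F" "convex F"
    unfolding F_def using assms by (auto intro: closed_hyperplane convex_Int convex_hyperplane)
  \<comment> \<open>As \<open>a \<noteq> 0\<close>, the right-hand interior is the open half-space,
    which misses \<open>F\<close>; hence no point of \<open>F\<close> is interior to
    \<open>A\<close>.\<close>
  have "interior A \<subseteq> interior {y. a \<bullet> y \<ge> a \<bullet> x}"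
    using a(2) by (intro interior_mono) auto
  then have "F \<subseteq> frontier A"
    using a(1) assms(1) by (auto simp: F_def frontier_def)
  have "bounded F"
  proof (rule ccontr)
    assume "\<not> bounded F"
    then obtain R where "is_ray R" "R \<subseteq> F"
      using unbounded_closed_convex_contains_ray \<open>closed F\<close> \<open>convex F\<close> by blast
    then show False using noray \<open>F \<subseteq> frontier A\<close> by blast
  qed
  then have "F = convex hull {y. y extreme_point_of F}"
    using \<open>closed F\<close> \<open>convex F\<close> by (intro Krein_Milman_Minkowski) (auto simp: compact_eq_bounded_closed)
  moreover have "{y. y extreme_point_of F} \<subseteq> profile A"
    using extreme_point_of_face[OF face] by (auto simp: profile_def)
  moreover have "x \<in> F" using x assms(1) by (auto simp: F_def frontier_def)
  ultimately show "x \<in> convex hull (profile A)"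
    using hull_mono[of "{y. y extreme_point_of F}" "profile A" convex] by auto
qed

lemma segment_meets_frontier:
  fixes x y :: "'a::euclidean_space"
  assumes "x \<in> A" "y \<notin> A"
  obtains p where "p \<in> frontier A" "p \<in> closed_segment x y"
  using connected_Int_frontier[of "closed_segment x y" A] assms by auto

theorem theorem12:
  fixes A :: "'a::euclidean_space set"
  assumes "A \<noteq> {}" and "closed A" and "convex A"
    and "\<not> (\<exists>H. is_hyperplane H \<and> H \<subseteq> A)"
    and "\<not> (\<exists>R. is_ray R \<and> R \<subseteq> frontier A)"
  shows "A = convex hull (profile A)"
proof
  have "profile A \<subseteq> A" by (auto simp: profile_def extreme_point_of_def)
  then show "convex hull (profile A) \<subseteq> A" using assms(3) by (rule hull_minimal)
next
  have hyp: "is_hyperplane {y. a \<bullet> y = b}" if "a \<noteq> 0" for a :: 'a and b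
    unfolding is_hyperplane_def using that
    by (simp add: affine_hyperplane Suc_leI)
  \<comment> \<open>The dimension is at least 1, so the whole space contains a hyperplane.\<close>
  have "A \<noteq> UNIV"
  proof
    assume "A = UNIV"
    obtain a :: 'a where "a \<in> Basis" using nonempty_Basis by blast
    then show False
      using assms(4) hyp[of a 0] nonzero_Basis \<open>A = UNIV\<close> by blast
  qed
  then obtain z where "z \<notin> A" by blast
  then obtain a b where a: "a \<bullet> z < b" "\<And>y. y \<in> A \<Longrightarrow> a \<bullet> y > b"
    using separating_hyperplane_closed_point[OF assms(3,2)] by blast
  have a0: "a \<noteq> 0" using a assms(1) by force
  show "A \<subseteq> convex hull (profile A)"
  proof
    \<comment> \<open>Interior and boundary points are treated alike: for a boundary point,
      \<open>p\<close> or \<open>q\<close> may be \<open>x\<close> itself.\<close>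
    fix x assume x: "x \<in> A"
    obtain w where w: "a \<bullet> w = a \<bullet> x" "w \<notin> A"
      using assms(4) hyp[OF a0, of "a \<bullet> x"] by blast
    obtain e where e: "e > 0" "\<And>y. dist y w < e \<Longrightarrow> y \<notin> A"
      using assms(2) w(2) unfolding closed_def open_dist by blast
    \<comment> \<open>The shift has length \<open>e / 2\<close>, so \<open>v\<close> stays in the
      ball about \<open>w\<close> that misses \<open>A\<close>, while \<open>a\<close> is now
      strictly larger at \<open>v\<close> than at \<open>x\<close>.\<close>
    define v where "v = w + (e / (2 * norm a)) *\<^sub>R a"
    have "v \<notin> A"
      using e a0 by (auto simp: v_def dist_norm)
    define c where "c = a \<bullet> (v - x)"
    have c: "c > 0" using e(1) a0 w(1) by (simp add: c_def v_def algebra_simps)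
    \<comment> \<open>Going backwards from \<open>x\<close>, \<open>a\<close> drops at rate
      \<open>c\<close>; after \<open>s\<close> it reaches the level \<open>b\<close>, strictly below
      all of \<open>A\<close>.\<close>
    define s where "s = (a \<bullet> x - b) / c"
    have s: "s > 0" using c a(2)[OF x] by (simp add: s_def)
    define u where "u = x - s *\<^sub>R (v - x)"
    have "a \<bullet> u = a \<bullet> x - s * c"
      by (simp add: u_def c_def inner_diff_right)
    then have "a \<bullet> u = b" using c by (simp add: s_def)
    then have "u \<notin> A" using a(2) by force
    obtain p where p: "p \<in> frontier A" "p \<in> closed_segment x v"
      using segment_meets_frontier[OF x \<open>v \<notin> A\<close>] by blast
    obtain q where q: "q \<in> frontier A" "q \<in> closed_segment x u"
      using segment_meets_frontier[OF x \<open>u \<notin> A\<close>] by blast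
    obtain \<alpha> where \<alpha>: "0 \<le> \<alpha>" "p = x + \<alpha> *\<^sub>R (v - x)"
      using p(2) by (auto simp: in_segment algebra_simps)
    obtain \<beta> where \<beta>: "0 \<le> \<beta>" "q = x - \<beta> *\<^sub>R (v - x)"
    proof -
      obtain r where "0 \<le> r" "q = (1 - r) *\<^sub>R x + r *\<^sub>R u"
        using q(2) by (auto simp: in_segment)
      then show thesis
        using that[of "r * s"] s by (simp add: u_def algebra_simps)
    qed
    have "x \<in> convex hull {p, q}"
    proof (cases "\<alpha> + \<beta> = 0")
      case True
      then have "x = p" using \<alpha> \<beta> by auto
      then show ?thesis by (simp add: hull_inc)
    next
      case False
      \<comment> \<open>Each endpoint is weighted by the distance parameter of the other, so that
        the multiples of \<open>v - x\<close> cancel.\<close>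
      define m where "m = \<beta> / (\<alpha> + \<beta>)"
      define n where "n = \<alpha> / (\<alpha> + \<beta>)"
      have mn: "m + n = 1"
        using False unfolding m_def n_def by (simp flip: add_divide_distrib add: add.commute)
      have "m * \<alpha> = n * \<beta>" by (simp add: m_def n_def)
      moreover have "m *\<^sub>R p + n *\<^sub>R q = (m + n) *\<^sub>R x + (m * \<alpha> - n * \<beta>) *\<^sub>R (v - x)"
        unfolding \<alpha>(2) \<beta>(2) by (simp add: algebra_simps)
      ultimately have "x = m *\<^sub>R p + n *\<^sub>R q" using mn by simp
      moreover have "0 \<le> m" "0 \<le> n" using \<alpha>(1) \<beta>(1) by (auto simp: m_def n_def)
      ultimately show ?thesis unfolding convex_hull_2 using mn by blast
    qed
    also have "convex hull {p, q} \<subseteq> convex hull (profile A)"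
      using frontier_subset_convex_hull_profile[OF assms(2,3,5)] p(1) q(1)
      by (intro hull_minimal) auto
    finally show "x \<in> convex hull (profile A)" .
  qed
qed

end
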